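(* Let $a\in(0,1)$ and let $\rho,\sigma_1,\sigma_2$ be states with $T(\sigma_1,\sigma_2)=t$. Then $$|S_a(\rho\|\sigma_1)-S_a(\rho\|\sigma_2)|\le 1-S_a(1\|t)=\frac{\log(a+(1-a)t)-\log a}{-\log a}\le \frac{1-a}{-a\log a}\,t.$$ Moreover, equality in the first inequality holds when $\rho\perp\sigma_1$ (i.e. $\mathrm{Tr}\,\rho\sigma_1=0$) and $\sigma_2=t\rho+(1-t)\sigma_1$.
   Context: All operators act on a finite-dimensional complex Hilbert space; a state is a positive semidefinite operator of trace one. $T(\rho,\sigma)=\frac12\|\rho-\sigma\|_1=\mathrm{Tr}(\rho-\sigma)_+$ is the trace distance, where $X_+=(X+|X|)/2$. For positive semidefinite $A,B$, the relative entropy is $S(A\|B)=\mathrm{Tr}\,A(\log A-\log B)$ (logarithms taken on supports, $0\log 0=0$, and $S(A\|B)=+\infty$ if the support of $A$ is not contained in that of $B$). For $a\in(0,1)$ the telescopic relative entropy is $S_a(A\|B)=\frac{1}{-\log a}S(A\|aA+(1-a)B)$. For nonnegative scalars $b,c$ this reads $S_a(b\|c)=\frac{b(\log b-\log(ab+(1-a)c))}{-\log a}$ (with $0\log 0=0$). *)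

theory Defs
  imports "HOL-Analysis.Analysis"
begin

type_synonym 'n cmat = "complex^'n^'n"

definition mtrace :: "'n::finite cmat \<Rightarrow> complex" where
  "mtrace A = (\<Sum>i\<in>UNIV. A $ i $ i)"

definition madj :: "'n::finite cmat \<Rightarrow> 'n cmat" where
  "madj A = (\<chi> i j. cnj (A $ j $ i))"

definition mdiag :: "('n::finite \<Rightarrow> complex) \<Rightarrow> 'n cmat" where
  "mdiag d = (\<chi> i j. if i = j then d i else 0)"

definition unitary_mat :: "'n::finite cmat \<Rightarrow> bool" where
  "unitary_mat U \<longleftrightarrow> madj U ** U = mat 1"

definition hermitian_mat :: "'n::finite cmat \<Rightarrow> bool" where
  "hermitian_mat A \<longleftrightarrow> madj A = A"

definition psd :: "'n::finite cmat \<Rightarrow> bool" where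
  "psd A \<longleftrightarrow> (\<forall>x::complex^'n.
     Im (\<Sum>i\<in>UNIV. cnj (x $ i) * (A *v x) $ i) = 0 \<and>
     Re (\<Sum>i\<in>UNIV. cnj (x $ i) * (A *v x) $ i) \<ge> 0)"

definition is_state :: "'n::finite cmat \<Rightarrow> bool" where
  "is_state \<rho> \<longleftrightarrow> psd \<rho> \<and> mtrace \<rho> = 1"

text \<open>Functional calculus for Hermitian matrices via spectral decomposition
  A = U diag(d) U*, f(A) = U diag(f o d) U* (independent of the decomposition).\<close>
definition mat_fun :: "(real \<Rightarrow> real) \<Rightarrow> 'n::finite cmat \<Rightarrow> 'n cmat" where
  "mat_fun f A = (SOME B. \<exists>U (d::'n \<Rightarrow> real). unitary_mat U \<and>
      A = U ** mdiag (\<lambda>i. complex_of_real (d i)) ** madj U \<and>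
      B = U ** mdiag (\<lambda>i. complex_of_real (f (d i))) ** madj U)"

definition pos_part :: "'n::finite cmat \<Rightarrow> 'n cmat" where
  "pos_part X = mat_fun (\<lambda>x. max x 0) X"

definition trace_dist :: "'n::finite cmat \<Rightarrow> 'n cmat \<Rightarrow> real" where
  "trace_dist \<rho> \<sigma> = Re (mtrace (pos_part (\<rho> - \<sigma>)))"

definition log_supp :: "'n::finite cmat \<Rightarrow> 'n cmat" where
  "log_supp A = mat_fun (\<lambda>x. if x > 0 then ln x else 0) A"

text \<open>supp A \<subseteq> supp B, equivalently ker B \<subseteq> ker A (for psd A, B).\<close>
definition supp_le :: "'n::finite cmat \<Rightarrow> 'n cmat \<Rightarrow> bool" where
  "supp_le A B \<longleftrightarrow> (\<forall>x. B *v x = 0 \<longrightarrow> A *v x = 0)"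

definition rel_ent :: "'n::finite cmat \<Rightarrow> 'n cmat \<Rightarrow> ereal" where
  "rel_ent A B = (if supp_le A B
      then ereal (Re (mtrace (A ** (log_supp A - log_supp B)))) else \<infinity>)"

definition tel_rel_ent :: "real \<Rightarrow> 'n::finite cmat \<Rightarrow> 'n cmat \<Rightarrow> ereal" where
  "tel_rel_ent a A B = rel_ent A (a *\<^sub>R A + (1 - a) *\<^sub>R B) / ereal (- ln a)"

definition tel_rel_ent_scalar :: "real \<Rightarrow> real \<Rightarrow> real \<Rightarrow> real" where
  "tel_rel_ent_scalar a b c =
     (if b = 0 then 0 else b * (ln b - ln (a * b + (1 - a) * c))) / (- ln a)"

end

theory Submission
  imports Defs "HOL-Real_Asymp.Real_Asymp"
begin

text \<open>
  Up to the factor \<open>1 / (- log a)\<close>, the entropy difference is \<open>Tr \<rho> (log D\<^sub>2 - log D\<^sub>1)\<close> with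
  \<open>D\<^sub>i = a \<rho> + (1 - a) \<sigma>\<^sub>i\<close>. As \<open>log\<close> is operator monotone and \<open>D\<^sub>2 \<le> D\<^sub>1 + X\<close> for
  \<open>X = (1 - a) (\<sigma>\<^sub>2 - \<sigma>\<^sub>1)\<^sub>+\<close>, it suffices to bound \<open>Tr \<rho> (log (D\<^sub>1 + X) - log D\<^sub>1)\<close> in terms of
  \<open>s = Tr X = (1 - a) t\<close>.

  Let \<open>\<langle>P, Q\<rangle> = Tr P T(Q)\<close>, where \<open>T\<close> is the derivative of \<open>log\<close> at \<open>D = D\<^sub>1 + \<theta> X\<close>. This form is
  positive semidefinite, nonnegative on pairs of positive semidefinite matrices, and
  \<open>\<langle>P, D\<rangle> = Tr P\<close>. As \<open>D \<ge> a \<rho> + \<theta> X\<close>, pairing with \<open>\<rho>\<close> and with \<open>X\<close> gives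
  \<open>a \<langle>\<rho>, \<rho>\<rangle> + \<theta> u \<le> 1\<close> and \<open>a u + \<theta> \<langle>X, X\<rangle> \<le> s\<close> for \<open>u = \<langle>\<rho>, X\<rangle>\<close>. Together with
  \<open>\<langle>X - s \<rho>, X - s \<rho>\<rangle> \<ge> 0\<close> this forces \<open>u \<le> s / (a + \<theta> s)\<close>, the derivative of \<open>log (a + \<theta> s)\<close>
  in \<open>\<theta>\<close>. By concavity of \<open>log\<close> the increment from \<open>\<theta>\<close> to \<open>\<eta>\<close> is at most \<open>(\<eta> - \<theta>) u\<close>, so the bound
  \<open>log (a + s) - log a\<close> follows. Singular \<open>D\<^sub>i\<close> are reached as limits of \<open>D\<^sub>i + \<epsilon>\<close>.
\<close>

subsection \<open>Matrix algebra\<close>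

interpretation matrix_mult: bounded_bilinear
  "(**) :: 'a::{euclidean_space,real_algebra_1}^'n^'m \<Rightarrow> 'a^'k^'n \<Rightarrow> 'a^'k^'m"
  unfolding bilinear_conv_bounded_bilinear[symmetric] bilinear_def
  by (auto intro!: linearI simp: matrix_matrix_mult_def vec_eq_iff algebra_simps sum.distrib scaleR_sum_right)

interpretation matrix_vector_mult: bounded_bilinear
  "(*v) :: 'a::{euclidean_space,real_algebra_1}^'n^'m \<Rightarrow> 'a^'n \<Rightarrow> 'a^'m"
  unfolding bilinear_conv_bounded_bilinear[symmetric] bilinear_def
  by (auto intro!: linearI simp: matrix_vector_mult_def vec_eq_iff algebra_simps sum.distrib scaleR_sum_right)

lemmas matrix_vector_scaleR = matrix_vector_mult.scaleR_left matrix_vector_mult.scaleR_right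

lemma column_matrix_mult: "column j (A ** B) = A *v column j B"
  by (simp add: column_def matrix_matrix_mult_def matrix_vector_mult_def)

lemma linear_madj: "linear madj"
  by (rule linearI) (simp_all add: madj_def vec_eq_iff)

lemmas madj_add = linear_add[OF linear_madj]
  and madj_diff = linear_diff[OF linear_madj]
  and madj_scaleR = linear_scale[OF linear_madj]

lemma madj_madj [simp]: "madj (madj A) = A"
  by (simp add: madj_def vec_eq_iff)

lemma madj_mult: "madj (A ** B) = madj B ** madj A"
  by (simp add: madj_def matrix_matrix_mult_def vec_eq_iff mult.commute)

lemma madj_mat_1 [simp]: "madj (mat 1) = mat 1"
  by (simp add: madj_def mat_def vec_eq_iff)

lemma madj_mdiag: "madj (mdiag d) = mdiag (\<lambda>i. cnj (d i))"
  by (simp add: madj_def mdiag_def vec_eq_iff)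

lemma mult_mdiag_nth: "(A ** mdiag d) $ i $ j = A $ i $ j * d j"
  by (simp add: mdiag_def matrix_matrix_mult_def if_distrib if_distribR cong: if_cong)

lemma hermitian_matD: "hermitian_mat A \<Longrightarrow> madj A = A"
  by (simp add: hermitian_mat_def)

lemma hermitian_mat_add: "hermitian_mat A \<Longrightarrow> hermitian_mat B \<Longrightarrow> hermitian_mat (A + B)"
  by (simp add: hermitian_mat_def madj_add)

lemma hermitian_mat_diff: "hermitian_mat A \<Longrightarrow> hermitian_mat B \<Longrightarrow> hermitian_mat (A - B)"
  by (simp add: hermitian_mat_def madj_diff)

lemma hermitian_mat_scaleR: "hermitian_mat A \<Longrightarrow> hermitian_mat (r *\<^sub>R A)"
  by (simp add: hermitian_mat_def madj_scaleR)

lemma unitary_matD: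
  assumes "unitary_mat U"
  shows "madj U ** U = mat 1" "U ** madj U = mat 1"
  using assms by (simp_all add: unitary_mat_def matrix_left_right_inverse)

lemma mtrace_eq_trace: "mtrace A = trace A"
  by (simp add: mtrace_def trace_def)

lemma linear_mtrace: "linear mtrace"
  by (rule linearI) (simp_all add: mtrace_def sum.distrib scaleR_sum_right)

lemmas mtrace_add = linear_add[OF linear_mtrace]
  and mtrace_diff = linear_diff[OF linear_mtrace]
  and mtrace_scaleR = linear_scale[OF linear_mtrace]

lemma mtrace_mult_commute: "mtrace (A ** B) = mtrace (B ** A)"
  unfolding mtrace_eq_trace by (rule trace_mul_sym)

definition trace_pair :: "'n::finite cmat \<Rightarrow> 'n cmat \<Rightarrow> real" where
  "trace_pair P Q = Re (mtrace (P ** Q))"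

interpretation trace_pair: bounded_bilinear "trace_pair :: 'n::finite cmat \<Rightarrow> 'n cmat \<Rightarrow> real"
  unfolding bilinear_conv_bounded_bilinear[symmetric] bilinear_def
  by (auto intro!: linearI simp: trace_pair_def matrix_mult.add_left matrix_mult.add_right
      matrix_mult.scaleR_left matrix_mult.scaleR_right mtrace_add mtrace_scaleR)

lemma trace_pair_commute: "trace_pair P Q = trace_pair Q P"
  unfolding trace_pair_def by (subst mtrace_mult_commute) (rule refl)

lemma trace_pair_mat_1 [simp]: "trace_pair P (mat 1) = Re (mtrace P)"
  by (simp add: trace_pair_def)

subsection \<open>The Hermitian inner product and definiteness\<close>

definition cdot :: "complex^'n::finite \<Rightarrow> complex^'n \<Rightarrow> complex" where
  "cdot x y = (\<Sum>i\<in>UNIV. cnj (x $ i) * y $ i)"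

interpretation cdot: bounded_bilinear "cdot :: complex^'n::finite \<Rightarrow> complex^'n \<Rightarrow> complex"
  unfolding bilinear_conv_bounded_bilinear[symmetric] bilinear_def
  by (auto intro!: linearI simp: cdot_def distrib_left distrib_right sum.distrib scaleR_sum_right)

lemma cdot_smult: "cdot (c *s x) y = cnj c * cdot x y" "cdot x (c *s y) = c * cdot x y"
  by (simp_all add: cdot_def sum_distrib_left mult_ac)

lemma cnj_cdot: "cnj (cdot x y) = cdot y x"
  by (simp add: cdot_def mult.commute)

lemma cdot_self: "cdot x x = of_real ((norm x)\<^sup>2)"
proof -
  have "(norm x)\<^sup>2 = (\<Sum>i\<in>UNIV. (norm (x $ i))\<^sup>2)"
    by (simp add: norm_vec_def L2_set_def sum_nonneg)
  then show ?thesis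
    by (simp add: cdot_def complex_norm_square mult.commute del: of_real_power)
qed

lemma cdot_matrix: "cdot x (A *v y) = cdot (madj A *v x) y"
  unfolding cdot_def matrix_vector_mult_def madj_def
  by (simp add: sum_distrib_left sum_distrib_right mult_ac) (rule sum.swap)

lemma madj_mult_nth: "(madj A ** B) $ i $ j = cdot (column i A) (column j B)"
  by (simp add: matrix_matrix_mult_def madj_def cdot_def column_def)

lemma diag_nth_eq_cdot: "A $ i $ i = cdot (column i (mat 1)) (A *v column i (mat 1))"
  using madj_mult_nth[of "mat 1" A i i] column_matrix_mult[of i A "mat 1"] by simp

lemma matrix_vector_cdot_eqI:
  assumes "\<And>x y. cdot x (A *v y) = cdot x (B *v y)"
  shows "A = B"
proof -
  have "A *v y = B *v y" for y
  proof -
    have "cdot (A *v y - B *v y) (A *v y - B *v y) = 0"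
      using assms by (simp add: cdot.diff_right)
    then show ?thesis by (simp add: cdot_self)
  qed
  then show ?thesis by (simp add: matrix_eq)
qed

lemma psd_cdot: "psd A \<longleftrightarrow> (\<forall>x. Im (cdot x (A *v x)) = 0 \<and> 0 \<le> Re (cdot x (A *v x)))"
  by (simp add: psd_def cdot_def)

lemma psd_hermitian:
  assumes "psd A"
  shows "hermitian_mat A"
proof -
  have real: "Im (cdot x (A *v x)) = 0" for x
    using assms by (simp add: psd_cdot)
  have Im_sum: "Im (cdot x (A *v y) + cdot y (A *v x)) = 0" for x y
    using real[of "x + y"] real[of x] real[of y]
    by (simp add: cdot.add_left cdot.add_right matrix_vector_mult.add_right)
  have Re_diff: "Re (cdot x (A *v y) - cdot y (A *v x)) = 0" for x y
    using Im_sum[of x "\<i> *s y"] by (simp add: cdot_smult vec.scale)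
  have "cdot x (madj A *v y) = cdot x (A *v y)" for x y
  proof -
    have "cdot x (madj A *v y) = cnj (cdot y (A *v x))"
      by (simp add: cdot_matrix cnj_cdot)
    also have "\<dots> = cdot x (A *v y)"
      using Im_sum[of x y] Re_diff[of x y] by (simp add: complex_eq_iff)
    finally show ?thesis .
  qed
  then show ?thesis
    unfolding hermitian_mat_def by (rule matrix_vector_cdot_eqI)
qed

lemma psd_mat_1: "psd (mat 1)"
  by (simp add: psd_cdot cdot_self)

lemma psd_add: "psd A \<Longrightarrow> psd B \<Longrightarrow> psd (A + B)"
  by (simp add: psd_cdot matrix_vector_mult.add_left cdot.add_right)

lemma psd_scaleR: "psd A \<Longrightarrow> 0 \<le> r \<Longrightarrow> psd (r *\<^sub>R A)"
  by (simp add: psd_cdot cdot.scaleR_right matrix_vector_scaleR)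

lemma psd_congruence: "psd A \<Longrightarrow> psd (madj C ** A ** C)"
  by (simp add: psd_cdot cdot_matrix[of _ "madj C"] flip: matrix_vector_mul_assoc)

lemma nonneg_quadratic_imp_linear_coeff_zero:
  fixes b c :: real
  assumes nonneg: "\<And>t. 0 \<le> 2 * t * b + t\<^sup>2 * c"
  shows "b = 0"
proof (rule ccontr)
  assume "b \<noteq> 0"
  define m where "m = \<bar>c\<bar> + 1"
  have m_bounds: "m > 0" "c < m" by (auto simp: m_def)
  have "0 \<le> 2 * (- b / m) * b + (- b / m)\<^sup>2 * c" by (rule nonneg)
  also have "\<dots> = (b / m)\<^sup>2 * (c - 2 * m)"
    using m_bounds by (simp add: field_simps power2_eq_square)
  also have "\<dots> < 0" using \<open>b \<noteq> 0\<close> m_bounds by (intro mult_pos_neg) auto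
  finally show False by simp
qed

lemma hermitian_form_zero_imp_kernel:
  assumes "hermitian_mat M" and V: "subspace V" "x \<in> V" "M *v x \<in> V"
    and nonneg: "\<And>y. y \<in> V \<Longrightarrow> 0 \<le> Re (cdot y (M *v y))"
    and zero: "Re (cdot x (M *v x)) = 0"
  shows "M *v x = 0"
proof -
  let ?y = "M *v x"
  have xMy: "cdot x (M *v ?y) = cdot ?y ?y"
    by (simp add: cdot_matrix[of x] hermitian_matD[OF assms(1)])
  have "0 \<le> 2 * t * Re (cdot ?y ?y) + t\<^sup>2 * Re (cdot ?y (M *v ?y))" for t
  proof -
    have "0 \<le> Re (cdot (x + t *\<^sub>R ?y) (M *v (x + t *\<^sub>R ?y)))"
      by (intro nonneg subspace_add subspace_scale V)
    also have "\<dots> = 2 * t * Re (cdot ?y ?y) + t\<^sup>2 * Re (cdot ?y (M *v ?y))"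
      by (simp add: cdot.add_left cdot.add_right cdot.scaleR_left cdot.scaleR_right xMy zero
          matrix_vector_mult.add_right matrix_vector_scaleR power2_eq_square algebra_simps)
    finally show ?thesis .
  qed
  then have "Re (cdot ?y ?y) = 0" by (rule nonneg_quadratic_imp_linear_coeff_zero)
  then show ?thesis by (simp add: cdot_self)
qed

lemma psd_form_zero_imp_kernel:
  assumes "psd A" "Re (cdot x (A *v x)) = 0"
  shows "A *v x = 0"
  using hermitian_form_zero_imp_kernel[OF psd_hermitian[OF assms(1)] subspace_UNIV] assms
  by (simp add: psd_cdot)

lemma psd_mtrace_nonneg: "psd A \<Longrightarrow> 0 \<le> Re (mtrace A)"
  unfolding mtrace_def by (auto intro!: sum_nonneg simp: diag_nth_eq_cdot psd_cdot)

lemma psd_mtrace_zero_imp_zero: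
  assumes "psd A" "mtrace A = 0"
  shows "A = 0"
proof -
  let ?e = "\<lambda>i. column i (mat 1)"
  have "(\<Sum>i\<in>UNIV. Re (cdot (?e i) (A *v ?e i))) = 0"
    using arg_cong[OF assms(2), of Re] by (simp add: mtrace_def diag_nth_eq_cdot)
  then have "Re (cdot (?e i) (A *v ?e i)) = 0" for i
    using assms(1) by (subst (asm) sum_nonneg_eq_0_iff) (auto simp: psd_cdot)
  then have "A *v ?e i = 0" for i
    by (rule psd_form_zero_imp_kernel[OF assms(1)])
  then have "column i A = 0" for i
    using column_matrix_mult[of i A "mat 1"] by simp
  then show ?thesis by (simp add: vec_eq_iff column_def)
qed

definition loewner_le :: "'n::finite cmat \<Rightarrow> 'n cmat \<Rightarrow> bool" (infix \<open>\<preceq>\<close> 50) where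
  "A \<preceq> B \<longleftrightarrow> psd (B - A)"

definition pos_def :: "'n::finite cmat \<Rightarrow> bool" where
  "pos_def A \<longleftrightarrow> hermitian_mat A \<and> (\<forall>x. x \<noteq> 0 \<longrightarrow> 0 < Re (cdot x (A *v x)))"

lemma pos_def_imp_psd:
  assumes "pos_def A"
  shows "psd A"
proof -
  have "cdot x (A *v x) = cnj (cdot x (A *v x))" for x
    using assms by (simp add: pos_def_def cnj_cdot cdot_matrix hermitian_matD)
  then have "Im (cdot x (A *v x)) = 0" for x
    by (simp add: complex_eq_iff)
  moreover have "0 \<le> Re (cdot x (A *v x))" for x
    using assms by (cases "x = 0") (auto simp: pos_def_def less_imp_le cdot.zero_left)
  ultimately show ?thesis by (simp add: psd_cdot)
qed

lemma pos_def_add_psd: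
  assumes "pos_def A" "psd B"
  shows "pos_def (A + B)"
  using assms psd_hermitian[OF assms(2)]
  by (auto simp: pos_def_def psd_cdot cdot.add_right matrix_vector_mult.add_left
      intro: hermitian_mat_add add_pos_nonneg)

lemma pos_def_scaleR_mat_1: "0 < r \<Longrightarrow> pos_def (r *\<^sub>R mat 1)"
  by (simp add: pos_def_def hermitian_mat_def madj_scaleR matrix_vector_scaleR cdot.scaleR_right cdot_self)

lemma pos_def_shift: "pos_def A \<Longrightarrow> 0 \<le> r \<Longrightarrow> pos_def (A + r *\<^sub>R mat 1)"
  by (intro pos_def_add_psd psd_scaleR psd_mat_1)

lemma psd_shift_pos_def: "psd A \<Longrightarrow> 0 < r \<Longrightarrow> pos_def (A + r *\<^sub>R mat 1)"
  by (metis pos_def_add_psd pos_def_scaleR_mat_1 add.commute)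

lemma pos_def_matrix_inv:
  assumes "pos_def A"
  shows "A ** matrix_inv A = mat 1" "matrix_inv A ** A = mat 1"
proof -
  have "x = 0" if "A *v x = 0" for x
    using assms that by (metis pos_def_def cdot.zero_right less_irrefl zero_complex.sel(1))
  then obtain B where "B ** A = mat 1"
    using matrix_left_invertible_ker by blast
  then have "\<exists>B. A ** B = mat 1 \<and> B ** A = mat 1"
    using matrix_left_right_inverse by blast
  from someI_ex[OF this] show "A ** matrix_inv A = mat 1" "matrix_inv A ** A = mat 1"
    by (simp_all add: matrix_inv_def)
qed

lemma psd_matrix_inv:
  assumes "pos_def A"
  shows "psd (matrix_inv A)"
proof -
  have "madj (matrix_inv A) ** A = mat 1"
    using arg_cong[OF pos_def_matrix_inv(1)[OF assms], of madj] assms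
    by (simp add: madj_mult pos_def_def hermitian_matD)
  then show ?thesis
    using psd_congruence[OF pos_def_imp_psd[OF assms], of "matrix_inv A"] by simp
qed

lemma matrix_inv_tangent:
  assumes A: "pos_def A" and B: "pos_def B"
  shows "matrix_inv A - matrix_inv B \<preceq> matrix_inv A ** (B - A) ** matrix_inv A"
proof -
  let ?A = "matrix_inv A" and ?B = "matrix_inv B"
  note inv = pos_def_matrix_inv[OF A] pos_def_matrix_inv[OF B]
  have "(?B - ?A) ** B ** (?B - ?A) = (mat 1 - ?A ** B) ** (?B - ?A)"
    by (simp add: matrix_mult.diff_left inv)
  also have "\<dots> = ?B - ?A - ?A ** (B ** ?B) + ?A ** B ** ?A"
    by (simp add: matrix_mult.diff_left matrix_mult.diff_right matrix_mul_assoc)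
  also have "\<dots> = ?A ** (B - A) ** ?A - (?A - ?B)"
    by (simp add: matrix_mult.diff_left matrix_mult.diff_right inv)
  finally have "?A ** (B - A) ** ?A - (?A - ?B) = madj (?B - ?A) ** B ** (?B - ?A)"
    using psd_matrix_inv[OF A] psd_matrix_inv[OF B]
    by (simp add: madj_diff hermitian_matD psd_hermitian)
  then show ?thesis
    unfolding loewner_le_def using psd_congruence[OF pos_def_imp_psd[OF B]] by metis
qed

subsection \<open>The spectral theorem\<close>

definition ortho_compl :: "(complex^'n::finite) set \<Rightarrow> (complex^'n) set" where
  "ortho_compl S = {x. \<forall>s\<in>S. cdot s x = 0}"

definition orthonormal_on :: "'i set \<Rightarrow> ('i \<Rightarrow> complex^'n::finite) \<Rightarrow> bool" where
  "orthonormal_on I f \<longleftrightarrow> (\<forall>i\<in>I. \<forall>j\<in>I. cdot (f i) (f j) = (if i = j then 1 else 0))"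

lemma subspace_ortho_compl: "subspace (ortho_compl S)"
  by (auto simp: ortho_compl_def subspace_def cdot.zero_right cdot.add_right cdot.scaleR_right)

lemma ortho_compl_image_nontrivial:
  fixes f :: "'n::finite \<Rightarrow> complex^'n"
  assumes "k \<notin> I"
  obtains z where "z \<noteq> 0" "z \<in> ortho_compl (f ` I)"
proof -
  define M where "M = (\<chi> i j. if i \<in> I then cnj (f i $ j) else 0)"
  have M_vec: "(M *v z) $ i = cdot (f i) z" if "i \<in> I" for i z
    using that by (simp add: M_def matrix_vector_mult_def cdot_def)
  have "(M ** B) $ k $ k = 0" for B :: "complex^'n^'n"
    using assms by (simp add: M_def matrix_matrix_mult_def)
  moreover have "(mat 1 :: complex^'n^'n) $ k $ k = 1"
    by (simp add: mat_def)
  ultimately have "M ** B \<noteq> mat 1" for B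
    by (metis zero_neq_one)
  then have "\<nexists>B. B ** M = mat 1"
    using matrix_left_right_inverse by metis
  then obtain z where "z \<noteq> 0" "M *v z = 0"
    using matrix_left_invertible_ker[of M] by blast
  then show ?thesis
    using that[of z] by (auto simp: ortho_compl_def simp flip: M_vec)
qed

lemma hermitian_ortho_compl_invariant:
  assumes "hermitian_mat A" and eigen: "\<And>s. s \<in> S \<Longrightarrow> \<exists>l. A *v s = l *\<^sub>R s"
    and "x \<in> ortho_compl S"
  shows "A *v x \<in> ortho_compl S"
proof -
  have "cdot s (A *v x) = 0" if s: "s \<in> S" for s
  proof -
    obtain l where "A *v s = l *\<^sub>R s" using eigen[OF s] by blast
    then show ?thesis
      using assms(1,3) s by (simp add: cdot_matrix hermitian_matD cdot.scaleR_left ortho_compl_def)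
  qed
  then show ?thesis by (simp add: ortho_compl_def)
qed

lemma quadratic_form_attains_max_on_subspace:
  fixes A :: "'n::finite cmat"
  assumes V: "subspace V" and z: "z \<in> V" "z \<noteq> 0"
  obtains x where "x \<in> V" "norm x = 1"
    "\<And>y. y \<in> V \<Longrightarrow> Re (cdot y (A *v y)) \<le> Re (cdot x (A *v x)) * (norm y)\<^sup>2"
proof -
  let ?q = "\<lambda>x. Re (cdot x (A *v x))"
  have normalised: "(1 / norm y) *\<^sub>R y \<in> sphere 0 1 \<inter> V" if "y \<in> V" "y \<noteq> 0" for y
    using that subspace_scale[OF V] by simp
  have "compact (sphere 0 1 \<inter> V)"
    using closed_subspace[OF V] by (simp add: compact_Int_closed)
  moreover have "continuous_on (sphere 0 1 \<inter> V) ?q"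
    by (intro continuous_intros cdot.continuous_on)
  moreover have "sphere 0 1 \<inter> V \<noteq> {}"
    using normalised[OF z] by blast
  ultimately obtain x where x: "x \<in> sphere 0 1 \<inter> V"
    and max: "\<And>y. y \<in> sphere 0 1 \<inter> V \<Longrightarrow> ?q y \<le> ?q x"
    using continuous_attains_sup[of "sphere 0 1 \<inter> V" ?q] by blast
  have "?q y \<le> ?q x * (norm y)\<^sup>2" if "y \<in> V" for y
  proof (cases "y = 0")
    case False
    from max[OF normalised[OF that False]] False show ?thesis
      by (simp add: cdot.scaleR_left cdot.scaleR_right matrix_vector_scaleR field_simps power2_eq_square)
  qed (simp add: cdot.zero_left)
  with x show ?thesis using that[of x] by simp
qed

lemma hermitian_eigenvector_in_subspace:
  fixes A :: "'n::finite cmat"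
  assumes "hermitian_mat A" and V: "subspace V" and invariant: "\<And>v. v \<in> V \<Longrightarrow> A *v v \<in> V"
    and "z \<in> V" "z \<noteq> 0"
  obtains x l where "x \<in> V" "norm x = 1" "A *v x = l *\<^sub>R x"
proof -
  from quadratic_form_attains_max_on_subspace[OF V \<open>z \<in> V\<close> \<open>z \<noteq> 0\<close>, of A]
  obtain x where x: "x \<in> V" "norm x = 1"
    and max: "\<And>y. y \<in> V \<Longrightarrow> Re (cdot y (A *v y)) \<le> Re (cdot x (A *v x)) * (norm y)\<^sup>2"
    by blast
  define l where "l = Re (cdot x (A *v x))"
  define M where "M = l *\<^sub>R mat 1 - A"
  have M_vec: "M *v y = l *\<^sub>R y - A *v y" for y
    by (simp add: M_def matrix_vector_mult.diff_left matrix_vector_scaleR)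
  have "M *v x = 0"
  proof (rule hermitian_form_zero_imp_kernel[OF _ V \<open>x \<in> V\<close>])
    show "hermitian_mat M"
      unfolding M_def
      by (intro hermitian_mat_diff hermitian_mat_scaleR psd_hermitian[OF psd_mat_1] assms(1))
    show "M *v x \<in> V"
      unfolding M_vec using V x(1) by (intro subspace_diff subspace_scale invariant)
    show "0 \<le> Re (cdot y (M *v y))" if "y \<in> V" for y
      using max[OF that] by (simp add: M_vec l_def cdot.diff_right cdot.scaleR_right cdot_self)
    show "Re (cdot x (M *v x)) = 0"
      using x(2) by (simp add: M_vec l_def cdot.diff_right cdot.scaleR_right cdot_self)
  qed
  then show ?thesis using that[of x l] x by (simp add: M_vec)
qed

lemma hermitian_orthonormal_eigenvectors:
  fixes A :: "'n::finite cmat" and I :: "'n set"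
  assumes "hermitian_mat A"
  shows "\<exists>f d. orthonormal_on I f \<and> (\<forall>i\<in>I. A *v f i = d i *\<^sub>R f i)"
using finite[of I]
proof (induction I rule: finite_induct)
  case empty
  show ?case by (simp add: orthonormal_on_def)
next
  case (insert k I)
  then obtain f d where orthonormal: "orthonormal_on I f" and eigen: "\<And>i. i \<in> I \<Longrightarrow> A *v f i = d i *\<^sub>R f i"
    by blast
  obtain z where z: "z \<noteq> 0" "z \<in> ortho_compl (f ` I)"
    using ortho_compl_image_nontrivial[OF \<open>k \<notin> I\<close>] by blast
  have "A *v v \<in> ortho_compl (f ` I)" if "v \<in> ortho_compl (f ` I)" for v
    using eigen that by (intro hermitian_ortho_compl_invariant[OF assms]) auto
  from hermitian_eigenvector_in_subspace[OF assms subspace_ortho_compl this z(2,1)]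
  obtain x l where x: "x \<in> ortho_compl (f ` I)" "norm x = 1" "A *v x = l *\<^sub>R x" by blast
  have "cdot (f i) x = 0" "cdot x (f i) = 0" if "i \<in> I" for i
    using x(1) that cnj_cdot[of "f i" x] by (auto simp: ortho_compl_def)
  then have "orthonormal_on (insert k I) (f(k := x))"
    using orthonormal \<open>k \<notin> I\<close> cdot_self[of x] x(2) by (auto simp: orthonormal_on_def)
  moreover have "\<forall>i\<in>insert k I. A *v (f(k := x)) i = (d(k := l)) i *\<^sub>R (f(k := x)) i"
    using eigen x(3) \<open>k \<notin> I\<close> by auto
  ultimately show ?case by blast
qed

lemma unitary_mat_iff_orthonormal_columns:
  "unitary_mat U \<longleftrightarrow> orthonormal_on UNIV (\<lambda>i. column i U)"
  by (simp add: unitary_mat_def orthonormal_on_def vec_eq_iff madj_mult_nth mat_def)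

lemma unitary_vec_eqI:
  assumes "unitary_mat U" and "\<And>i. cdot (column i U) x = cdot (column i U) y"
  shows "x = y"
proof -
  have "(madj U *v x) $ i = cdot (column i U) x" for i x
    by (simp add: matrix_vector_mult_def madj_def cdot_def column_def)
  then have "madj U *v x = madj U *v y"
    using assms(2) by (simp add: vec_eq_iff)
  then have "(U ** madj U) *v x = (U ** madj U) *v y"
    by (simp flip: matrix_vector_mul_assoc)
  then show ?thesis by (simp add: unitary_matD[OF assms(1)])
qed

lemma unitary_matrix_eqI:
  assumes "unitary_mat U" and "\<And>i. A *v column i U = B *v column i U"
  shows "A = B"
proof -
  have "column j (A ** U) = column j (B ** U)" for j
    by (simp add: column_matrix_mult assms(2))
  then have "A ** U = B ** U"
    by (simp add: vec_eq_iff column_def)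
  then have "A ** (U ** madj U) = B ** (U ** madj U)"
    by (simp add: matrix_mul_assoc)
  then show ?thesis by (simp add: unitary_matD[OF assms(1)])
qed

subsection \<open>Functional calculus\<close>

definition unitary_diag :: "'n::finite cmat \<Rightarrow> ('n \<Rightarrow> real) \<Rightarrow> 'n cmat" where
  "unitary_diag U d = U ** mdiag (\<lambda>i. complex_of_real (d i)) ** madj U"

lemma hermitian_unitary_diag: "hermitian_mat (unitary_diag U d)"
  by (simp add: hermitian_mat_def unitary_diag_def madj_mult madj_mdiag matrix_mul_assoc)

lemma unitary_diag_mult_column:
  assumes "unitary_mat U"
  shows "unitary_diag U d *v column i U = d i *\<^sub>R column i U"
proof -
  have "unitary_diag U d ** U = U ** mdiag (\<lambda>i. complex_of_real (d i)) ** (madj U ** U)"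
    by (simp add: unitary_diag_def matrix_mul_assoc)
  then have "unitary_diag U d ** U = U ** mdiag (\<lambda>i. complex_of_real (d i))"
    by (simp add: unitary_matD[OF assms])
  then have "column i (unitary_diag U d ** U) = d i *\<^sub>R column i U"
    by (simp add: column_def mult_mdiag_nth vec_eq_iff scaleR_conv_of_real[where 'a = complex])
  then show ?thesis by (simp add: column_matrix_mult)
qed

lemma unitary_diag_eqI:
  assumes "unitary_mat U" and "\<And>i. A *v column i U = d i *\<^sub>R column i U"
  shows "A = unitary_diag U d"
  using assms by (intro unitary_matrix_eqI[of U]) (simp_all add: unitary_diag_mult_column)

theorem spectral_decomposition:
  fixes A :: "'n::finite cmat"
  assumes "hermitian_mat A"
  obtains U d where "unitary_mat U" "A = unitary_diag U d"
proof -
  obtain f and d :: "'n \<Rightarrow> real" where orthonormal: "orthonormal_on UNIV f" and eigen: "\<And>i. A *v f i = d i *\<^sub>R f i"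
    using hermitian_orthonormal_eigenvectors[OF assms, of UNIV] by blast
  define U where "U = (\<chi> i j. f j $ i)"
  have column: "column i U = f i" for i
    by (simp add: U_def column_def)
  then have "unitary_mat U"
    using orthonormal by (simp add: unitary_mat_iff_orthonormal_columns)
  moreover from this have "A = unitary_diag U d"
    by (rule unitary_diag_eqI) (simp add: column eigen)
  ultimately show ?thesis by (rule that)
qed

lemma unitary_diag_mult:
  "unitary_mat U \<Longrightarrow> unitary_diag U d ** unitary_diag U e = unitary_diag U (\<lambda>i. d i * e i)"
  by (rule unitary_diag_eqI)
    (simp_all add: unitary_diag_mult_column matrix_vector_scaleR mult.commute flip: matrix_vector_mul_assoc)

lemma unitary_diag_add:
  "unitary_mat U \<Longrightarrow> unitary_diag U d + unitary_diag U e = unitary_diag U (\<lambda>i. d i + e i)"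
  by (rule unitary_diag_eqI)
    (simp_all add: unitary_diag_mult_column matrix_vector_mult.add_left scaleR_add_left)

lemma unitary_diag_scaleR:
  "unitary_mat U \<Longrightarrow> r *\<^sub>R unitary_diag U d = unitary_diag U (\<lambda>i. r * d i)"
  by (rule unitary_diag_eqI) (simp_all add: unitary_diag_mult_column matrix_vector_scaleR)

lemma unitary_diag_const: "unitary_mat U \<Longrightarrow> unitary_diag U (\<lambda>_. r) = r *\<^sub>R mat 1"
  by (rule unitary_diag_eqI[symmetric]) (simp_all add: matrix_vector_scaleR)

lemma unitary_diag_shift:
  "unitary_mat U \<Longrightarrow> unitary_diag U d + r *\<^sub>R mat 1 = unitary_diag U (\<lambda>i. d i + r)"
  by (simp add: unitary_diag_add flip: unitary_diag_const)

lemma cdot_unitary_diag_column: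
  assumes "unitary_mat U"
  shows "cdot (column i U) (unitary_diag U d *v column i U) = d i"
  using assms by (simp add: unitary_diag_mult_column cdot.scaleR_right scaleR_conv_of_real[where 'a = complex]
      unitary_mat_iff_orthonormal_columns orthonormal_on_def)

lemma psd_unitary_diag_iff:
  assumes "unitary_mat U"
  shows "psd (unitary_diag U d) \<longleftrightarrow> (\<forall>i. 0 \<le> d i)"
proof
  assume "psd (unitary_diag U d)"
  then show "\<forall>i. 0 \<le> d i"
    by (metis psd_cdot cdot_unitary_diag_column[OF assms] Re_complex_of_real)
next
  let ?S = "unitary_diag U (\<lambda>i. sqrt (d i))"
  assume "\<forall>i. 0 \<le> d i"
  then have "unitary_diag U d = madj ?S ** mat 1 ** ?S"
    by (simp add: unitary_diag_mult[OF assms] hermitian_matD[OF hermitian_unitary_diag])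
  then show "psd (unitary_diag U d)"
    by (simp only: psd_congruence[OF psd_mat_1])
qed

lemma pos_def_unitary_diag_pos:
  assumes "unitary_mat U" "pos_def (unitary_diag U d)"
  shows "0 < d i"
proof -
  have "cdot (column i U) (column i U) = 1"
    using assms(1) by (simp add: unitary_mat_iff_orthonormal_columns orthonormal_on_def)
  then have "column i U \<noteq> 0" by (auto simp: cdot.zero_left)
  then show ?thesis
    using assms(2) by (metis pos_def_def cdot_unitary_diag_column[OF assms(1)] Re_complex_of_real)
qed

lemma psd_decomposition:
  assumes "psd A"
  obtains U d where "unitary_mat U" "A = unitary_diag U d" "\<And>i. 0 \<le> d i"
proof -
  obtain U d where U: "unitary_mat U" "A = unitary_diag U d"
    using spectral_decomposition[OF psd_hermitian[OF assms]] .
  then show ?thesis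
    using that assms by (simp add: psd_unitary_diag_iff)
qed

lemma pos_def_decomposition:
  assumes "pos_def A"
  obtains U d where "unitary_mat U" "A = unitary_diag U d" "\<And>i. 0 < d i"
proof -
  obtain U d where U: "unitary_mat U" "A = unitary_diag U d"
    using spectral_decomposition assms unfolding pos_def_def by blast
  then show ?thesis
    using that assms pos_def_unitary_diag_pos by blast
qed

lemma psd_square_root:
  assumes "psd A"
  obtains S where "hermitian_mat S" "A = S ** S"
proof -
  obtain U d where "unitary_mat U" "A = unitary_diag U d" "\<And>i. 0 \<le> d i"
    using psd_decomposition[OF assms] by blast
  then have "A = unitary_diag U (\<lambda>i. sqrt (d i)) ** unitary_diag U (\<lambda>i. sqrt (d i))"
    by (simp add: unitary_diag_mult)
  then show ?thesis using that hermitian_unitary_diag by blast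
qed

lemma trace_pair_psd_nonneg:
  assumes "psd P" "psd Q"
  shows "0 \<le> trace_pair P Q"
proof -
  obtain S where S: "hermitian_mat S" "Q = S ** S"
    using psd_square_root[OF assms(2)] .
  have "trace_pair P Q = Re (mtrace (madj S ** P ** S))"
    unfolding trace_pair_def S(2) matrix_mul_assoc mtrace_mult_commute[of "P ** S"]
    by (simp add: hermitian_matD[OF S(1)] matrix_mul_assoc)
  then show ?thesis
    using psd_mtrace_nonneg[OF psd_congruence[OF assms(1)]] by simp
qed

lemma psd_mtrace_mult_zero_imp_mult_zero:
  assumes "psd P" "psd Q" "mtrace (P ** Q) = 0"
  shows "P ** Q = 0"
proof -
  obtain S where S: "hermitian_mat S" "Q = S ** S"
    using psd_square_root[OF assms(2)] .
  have "mtrace (madj S ** P ** S) = mtrace (P ** Q)"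
    unfolding S(2) matrix_mul_assoc mtrace_mult_commute[of "P ** S"]
    by (simp add: hermitian_matD[OF S(1)] matrix_mul_assoc)
  with assms(3) have "madj S ** P ** S = 0"
    using psd_mtrace_zero_imp_zero[OF psd_congruence[OF assms(1)]] by simp
  then have "cdot (S *v x) (P *v (S *v x)) = 0" for x
    using cdot_matrix[of x "madj S" "P *v (S *v x)"]
    by (simp add: matrix_vector_mul_assoc matrix_mul_assoc cdot.zero_right)
  then have "P *v (S *v x) = 0" for x
    by (intro psd_form_zero_imp_kernel[OF assms(1)]) simp
  then have "P ** S = 0"
    by (simp add: matrix_eq flip: matrix_vector_mul_assoc)
  then show ?thesis by (simp add: S(2) matrix_mul_assoc)
qed

lemma unitary_diag_fun_mult_eigenvector:
  assumes U: "unitary_mat U" and eigen: "unitary_diag U d *v x = l *\<^sub>R x"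
  shows "unitary_diag U (\<lambda>i. f (d i)) *v x = f l *\<^sub>R x"
proof (rule unitary_vec_eqI[OF U])
  fix i
  have coordinate: "cdot (column i U) (unitary_diag U g *v x) = g i *\<^sub>R cdot (column i U) x" for g
    by (simp add: cdot_matrix hermitian_matD[OF hermitian_unitary_diag] unitary_diag_mult_column[OF U]
        cdot.scaleR_left)
  have "d i = l \<or> cdot (column i U) x = 0"
    using arg_cong[OF eigen, of "cdot (column i U)"] by (auto simp: coordinate cdot.scaleR_right)
  then show "cdot (column i U) (unitary_diag U (\<lambda>i. f (d i)) *v x) = cdot (column i U) (f l *\<^sub>R x)"
    by (auto simp: coordinate cdot.scaleR_right)
qed

lemma mat_fun_unitary_diag:
  assumes U: "unitary_mat U"
  shows "mat_fun f (unitary_diag U d) = unitary_diag U (\<lambda>i. f (d i))"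
  unfolding mat_fun_def unitary_diag_def[symmetric]
proof (rule some_equality)
  show "\<exists>V b. unitary_mat V \<and> unitary_diag U d = unitary_diag V b \<and>
      unitary_diag U (\<lambda>i. f (d i)) = unitary_diag V (\<lambda>i. f (b i))"
    using U by blast
next
  fix B
  assume "\<exists>V b. unitary_mat V \<and> unitary_diag U d = unitary_diag V b \<and> B = unitary_diag V (\<lambda>i. f (b i))"
  then obtain V b where V: "unitary_mat V" "unitary_diag U d = unitary_diag V b"
    and B: "B = unitary_diag V (\<lambda>i. f (b i))" by blast
  have "unitary_diag U (\<lambda>i. f (d i)) *v column j V = f (b j) *\<^sub>R column j V" for j
    by (rule unitary_diag_fun_mult_eigenvector[OF U]) (simp add: V unitary_diag_mult_column)
  then show "B = unitary_diag U (\<lambda>i. f (d i))"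
    unfolding B by (intro unitary_diag_eqI[OF V(1), symmetric])
qed

lemma mat_fun_intertwines:
  assumes "hermitian_mat A" "hermitian_mat B" and intertwines: "A ** C = C ** B"
  shows "mat_fun f A ** C = C ** mat_fun f B"
proof -
  obtain U d where U: "unitary_mat U" "A = unitary_diag U d"
    using spectral_decomposition[OF assms(1)] .
  obtain V b where V: "unitary_mat V" "B = unitary_diag V b"
    using spectral_decomposition[OF assms(2)] .
  show ?thesis
  proof (rule unitary_matrix_eqI[OF V(1)])
    fix j
    have "A *v (C *v column j V) = b j *\<^sub>R (C *v column j V)"
      by (simp add: matrix_vector_mul_assoc intertwines)
        (simp add: V unitary_diag_mult_column matrix_vector_scaleR flip: matrix_vector_mul_assoc)
    then have "mat_fun f A *v (C *v column j V) = f (b j) *\<^sub>R (C *v column j V)"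
      unfolding U(2) mat_fun_unitary_diag[OF U(1)] by (rule unitary_diag_fun_mult_eigenvector[OF U(1)])
    also have "\<dots> = C *v (mat_fun f B *v column j V)"
      by (simp add: V mat_fun_unitary_diag unitary_diag_mult_column matrix_vector_scaleR)
    finally show "(mat_fun f A ** C) *v column j V = (C ** mat_fun f B) *v column j V"
      by (simp add: matrix_vector_mul_assoc)
  qed
qed

definition eigenproj :: "'n::finite cmat \<Rightarrow> 'n \<Rightarrow> 'n cmat" where
  "eigenproj U i = unitary_diag U (\<lambda>k. if k = i then 1 else 0)"

lemma eigenproj_mult_column:
  "unitary_mat U \<Longrightarrow> eigenproj U i *v column j U = (if j = i then column j U else 0)"
  by (simp add: eigenproj_def unitary_diag_mult_column)

lemma unitary_diag_eq_sum_eigenproj: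
  assumes "unitary_mat U"
  shows "unitary_diag U d = (\<Sum>i\<in>UNIV. d i *\<^sub>R eigenproj U i)"
proof (rule unitary_diag_eqI[OF assms, symmetric])
  fix j
  have "(\<Sum>i\<in>UNIV. d i *\<^sub>R eigenproj U i) *v column j U = (\<Sum>i\<in>UNIV. if j = i then d i *\<^sub>R column j U else 0)"
    unfolding matrix_vector_mult.sum_left
    by (intro sum.cong refl) (simp add: matrix_vector_scaleR eigenproj_mult_column[OF assms])
  then show "(\<Sum>i\<in>UNIV. d i *\<^sub>R eigenproj U i) *v column j U = d j *\<^sub>R column j U" by simp
qed

lemma trace_pair_unitary_diag:
  "unitary_mat U \<Longrightarrow> trace_pair P (unitary_diag U d) = (\<Sum>i\<in>UNIV. d i * trace_pair P (eigenproj U i))"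
  by (simp add: unitary_diag_eq_sum_eigenproj trace_pair.sum_right trace_pair.scaleR_right)

lemma sum_trace_pair_eigenproj:
  "unitary_mat U \<Longrightarrow> (\<Sum>i\<in>UNIV. trace_pair P (eigenproj U i)) = Re (mtrace P)"
  using trace_pair_unitary_diag[of U P "\<lambda>_. 1"] by (simp add: unitary_diag_const)

subsection \<open>Resolvents and the integral representation of the logarithm\<close>

lemma has_integral_atLeast_FTC:
  fixes f F :: "real \<Rightarrow> real"
  assumes deriv: "\<And>x. a \<le> x \<Longrightarrow> (F has_real_derivative f x) (at x)"
    and nonneg: "\<And>x. a \<le> x \<Longrightarrow> 0 \<le> f x"
    and lim: "(F \<longlongrightarrow> l) at_top"
  shows "(f has_integral (l - F a)) {a..}"
proof (rule has_integral_to_inf)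
  have FTC: "(f has_integral (F y - F a)) {a..y}" if "a \<le> y" for y
    using that deriv
    by (intro fundamental_theorem_of_calculus)
      (auto intro: has_field_derivative_at_within simp flip: has_real_derivative_iff_has_vector_derivative)
  show "f integrable_on {a..y}" for y
  proof (cases "a \<le> y")
    case True
    then show ?thesis using FTC by blast
  qed (simp add: integrable_on_empty)
  have "\<forall>\<^sub>F y in at_top. F y - F a = integral {a..y} f"
    using eventually_ge_at_top[of a] by eventually_elim (metis FTC integral_unique)
  then show "((\<lambda>y. integral {a..y} f) \<longlongrightarrow> l - F a) at_top"
    by (rule Lim_transform_eventually[rotated]) (intro tendsto_intros lim)
qed (rule nonneg)

lemma has_integral_inverse_product:
  fixes x y :: real
  assumes "0 < x" "0 < y" "x \<noteq> y"
  shows "((\<lambda>r. 1 / ((x + r) * (y + r))) has_integral ((ln y - ln x) / (y - x))) {0..}"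
proof -
  let ?F = "\<lambda>r. (ln (x + r) - ln (y + r)) / (y - x)"
  have "((\<lambda>r. 1 / ((x + r) * (y + r))) has_integral (0 - ?F 0)) {0..}"
  proof (rule has_integral_atLeast_FTC)
    fix r :: real assume "0 \<le> r"
    have "(?F has_real_derivative ((1 / (x + r) - 1 / (y + r)) / (y - x))) (at r)"
      using assms \<open>0 \<le> r\<close> by (auto intro!: derivative_eq_intros)
    also have "(1 / (x + r) - 1 / (y + r)) / (y - x) = 1 / ((x + r) * (y + r))"
      using assms \<open>0 \<le> r\<close> by (simp add: divide_simps)
    finally show "(?F has_real_derivative (1 / ((x + r) * (y + r)))) (at r)" .
    show "0 \<le> 1 / ((x + r) * (y + r))" using assms \<open>0 \<le> r\<close> by simp
  next
    have "((\<lambda>r. ln (x + r) - ln (y + r)) \<longlongrightarrow> 0) at_top" by real_asymp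
    then show "(?F \<longlongrightarrow> 0) at_top" by (rule tendsto_divide_zero)
  qed
  then show ?thesis by (simp add: diff_divide_distrib)
qed

lemma has_integral_inverse_square:
  fixes x :: real
  assumes "0 < x"
  shows "((\<lambda>r. 1 / (x + r)\<^sup>2) has_integral (1 / x)) {0..}"
proof -
  have "((\<lambda>r. 1 / (x + r)\<^sup>2) has_integral (0 - (- 1 / (x + 0)))) {0..}"
  proof (rule has_integral_atLeast_FTC)
    show "((\<lambda>r. - 1 / (x + r)) has_real_derivative (1 / (x + r)\<^sup>2)) (at r)" if "0 \<le> r" for r
      using assms that by (auto intro!: derivative_eq_intros simp: power2_eq_square)
    show "((\<lambda>r. - 1 / (x + r)) \<longlongrightarrow> 0) at_top" by real_asymp
  qed simp
  then show ?thesis by simp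
qed

lemma integrable_inverse_product:
  fixes x y :: real
  assumes "0 < x" "0 < y"
  shows "(\<lambda>r. 1 / ((x + r) * (y + r))) integrable_on {0..}"
  using has_integral_inverse_product[OF assms] has_integral_inverse_square[OF assms(1)]
  by (cases "x = y") (auto simp: power2_eq_square)

lemma has_integral_ln:
  fixes x :: real
  assumes "0 < x"
  shows "((\<lambda>r. 1 / (1 + r) - 1 / (x + r)) has_integral ln x) {0..}"
proof (cases "x = 1")
  case False
  have "((\<lambda>r. (x - 1) * (1 / ((1 + r) * (x + r)))) has_integral (x - 1) * ((ln x - ln 1) / (x - 1))) {0..}"
    using assms False by (intro has_integral_mult_right has_integral_inverse_product) auto
  also have "(x - 1) * ((ln x - ln 1) / (x - 1)) = ln x"
    using False by simp
  finally show ?thesis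
    by (rule has_integral_eq[rotated]) (use assms in \<open>auto simp: divide_simps\<close>)
qed simp

definition resolvent :: "'n::finite cmat \<Rightarrow> real \<Rightarrow> 'n cmat" where
  "resolvent A r = matrix_inv (A + r *\<^sub>R mat 1)"

lemma psd_resolvent: "pos_def A \<Longrightarrow> 0 \<le> r \<Longrightarrow> psd (resolvent A r)"
  unfolding resolvent_def by (intro psd_matrix_inv pos_def_shift)

lemma resolvent_unitary_diag:
  assumes U: "unitary_mat U" and pos_def: "pos_def (unitary_diag U d)" and "0 \<le> r"
  shows "resolvent (unitary_diag U d) r = unitary_diag U (\<lambda>i. 1 / (d i + r))"
proof -
  let ?A = "unitary_diag U d + r *\<^sub>R mat 1"
  have shift: "?A = unitary_diag U (\<lambda>i. d i + r)"
    by (rule unitary_diag_shift[OF U])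
  have "d i + r \<noteq> 0" for i
    using pos_def_unitary_diag_pos[OF U pos_def, of i] \<open>0 \<le> r\<close> by simp
  then have "?A ** unitary_diag U (\<lambda>i. 1 / (d i + r)) = mat 1"
    unfolding shift by (simp add: unitary_diag_mult[OF U] unitary_diag_const[OF U])
  then have "matrix_inv ?A ** ?A ** unitary_diag U (\<lambda>i. 1 / (d i + r)) = matrix_inv ?A"
    by (simp flip: matrix_mul_assoc)
  then show ?thesis
    by (simp add: resolvent_def pos_def_matrix_inv pos_def_shift[OF pos_def \<open>0 \<le> r\<close>])
qed

lemma trace_pair_log_supp_unitary_diag:
  assumes "unitary_mat U" "\<And>i. 0 \<le> d i"
  shows "trace_pair P (log_supp (unitary_diag U d)) = (\<Sum>i\<in>UNIV. ln (d i) * trace_pair P (eigenproj U i))"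
proof -
  have "(if 0 < d i then ln (d i) else 0) = ln (d i)" for i
    using assms(2)[of i] by (cases "d i = 0") auto \<comment> \<open>\<open>ln 0 = 0\<close>\<close>
  then show ?thesis
    by (simp add: log_supp_def mat_fun_unitary_diag trace_pair_unitary_diag assms(1))
qed

lemma trace_pair_log_supp_has_integral:
  assumes "pos_def A"
  shows "((\<lambda>r. trace_pair P ((1 / (1 + r)) *\<^sub>R mat 1 - resolvent A r))
      has_integral trace_pair P (log_supp A)) {0..}"
proof -
  obtain U d where U: "unitary_mat U" and A: "A = unitary_diag U d" and d_pos: "\<And>i. 0 < d i"
    using pos_def_decomposition[OF assms] by blast
  let ?p = "\<lambda>i. trace_pair P (eigenproj U i)"
  have integrand: "(\<Sum>i\<in>UNIV. (1 / (1 + r) - 1 / (d i + r)) * ?p i)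
      = trace_pair P ((1 / (1 + r)) *\<^sub>R mat 1 - resolvent A r)" if "0 \<le> r" for r
    using assms that
    by (simp add: A resolvent_unitary_diag[OF U] trace_pair.diff_right trace_pair_unitary_diag[OF U]
        left_diff_distrib sum_subtractf flip: unitary_diag_const[OF U])
  have "((\<lambda>r. \<Sum>i\<in>UNIV. (1 / (1 + r) - 1 / (d i + r)) * ?p i) has_integral (\<Sum>i\<in>UNIV. ln (d i) * ?p i)) {0..}"
    by (intro has_integral_sum has_integral_mult_left has_integral_ln d_pos finite)
  moreover have "(\<Sum>i\<in>UNIV. ln (d i) * ?p i) = trace_pair P (log_supp A)"
    by (simp add: A trace_pair_log_supp_unitary_diag[OF U] d_pos less_imp_le)
  ultimately show ?thesis
    by (auto intro: has_integral_eq integrand)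
qed

subsection \<open>The Bogoliubov--Kubo--Mori form\<close>

text \<open>The pairing of \<open>P\<close> with the derivative of \<open>log\<close> at \<open>A\<close> in the direction \<open>Q\<close>.\<close>

definition bkm_form :: "'n::finite cmat \<Rightarrow> 'n cmat \<Rightarrow> 'n cmat \<Rightarrow> real" where
  "bkm_form A P Q = integral {0..} (\<lambda>r. trace_pair P (resolvent A r ** Q ** resolvent A r))"

lemma bkm_form_integrable:
  assumes "pos_def A"
  shows "(\<lambda>r. trace_pair P (resolvent A r ** Q ** resolvent A r)) integrable_on {0..}"
proof -
  obtain U d where U: "unitary_mat U" and A: "A = unitary_diag U d" and d_pos: "\<And>i. 0 < d i"
    using pos_def_decomposition[OF assms] by blast
  let ?p = "\<lambda>i j. trace_pair P (eigenproj U i ** Q ** eigenproj U j)"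
  have "(\<Sum>j\<in>UNIV. \<Sum>i\<in>UNIV. 1 / ((d j + r) * (d i + r)) * ?p i j)
      = trace_pair P (resolvent A r ** Q ** resolvent A r)" if "0 \<le> r" for r
    using assms that
    by (simp add: A resolvent_unitary_diag[OF U] unitary_diag_eq_sum_eigenproj[OF U, of "\<lambda>i. 1 / (d i + r)"]
        matrix_mult.sum_left matrix_mult.sum_right matrix_mult.scaleR_left matrix_mult.scaleR_right
        trace_pair.sum_right trace_pair.scaleR_right sum_divide_distrib mult.commute)
  moreover have "(\<lambda>r. \<Sum>j\<in>UNIV. \<Sum>i\<in>UNIV. 1 / ((d j + r) * (d i + r)) * ?p i j) integrable_on {0..}"
    by (intro integrable_sum integrable_on_mult_left integrable_inverse_product d_pos finite)
  ultimately show ?thesis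
    by (auto intro: integrable_eq)
qed

lemma bkm_form_commute: "bkm_form A P Q = bkm_form A Q P"
proof -
  have "trace_pair P (R ** Q ** R) = trace_pair Q (R ** P ** R)" for R
    using mtrace_mult_commute[of "P ** R" "Q ** R"] by (simp add: trace_pair_def matrix_mul_assoc)
  then show ?thesis by (simp add: bkm_form_def)
qed

lemma bkm_form_diff_right: "pos_def A \<Longrightarrow> bkm_form A P (Q - R) = bkm_form A P Q - bkm_form A P R"
  by (simp add: bkm_form_def matrix_mult.diff_left matrix_mult.diff_right trace_pair.diff_right
      integral_diff bkm_form_integrable)

lemma bkm_form_scaleR_right: "bkm_form A P (c *\<^sub>R Q) = c * bkm_form A P Q"
  by (simp add: bkm_form_def matrix_mult.scaleR_left matrix_mult.scaleR_right trace_pair.scaleR_right)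

lemma bkm_form_diff_left: "pos_def A \<Longrightarrow> bkm_form A (P - Q) R = bkm_form A P R - bkm_form A Q R"
  by (metis bkm_form_commute bkm_form_diff_right)

lemma bkm_form_scaleR_left: "bkm_form A (c *\<^sub>R P) Q = c * bkm_form A P Q"
  by (metis bkm_form_commute bkm_form_scaleR_right)

lemma bkm_form_psd_nonneg:
  assumes "pos_def A" "psd P" "psd Q"
  shows "0 \<le> bkm_form A P Q"
  unfolding bkm_form_def
proof (rule integral_nonneg[OF bkm_form_integrable[OF assms(1)]])
  fix r :: real assume "r \<in> {0..}"
  then have "hermitian_mat (resolvent A r)"
    using assms(1) by (simp add: psd_hermitian psd_resolvent)
  then show "0 \<le> trace_pair P (resolvent A r ** Q ** resolvent A r)"
    using trace_pair_psd_nonneg[OF assms(2) psd_congruence[OF assms(3), of "resolvent A r"]]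
    by (simp add: hermitian_matD)
qed

lemma bkm_form_self_nonneg:
  assumes "pos_def A" "hermitian_mat P"
  shows "0 \<le> bkm_form A P P"
  unfolding bkm_form_def
proof (rule integral_nonneg[OF bkm_form_integrable[OF assms(1)]])
  fix r :: real assume "r \<in> {0..}"
  then have R: "psd (resolvent A r)"
    using assms(1) by (simp add: psd_resolvent)
  then have "0 \<le> trace_pair (P ** resolvent A r ** P) (resolvent A r)"
    using trace_pair_psd_nonneg[OF psd_congruence[OF R, of P] R] by (simp add: hermitian_matD[OF assms(2)])
  then show "0 \<le> trace_pair P (resolvent A r ** P ** resolvent A r)"
    by (simp add: trace_pair_def matrix_mul_assoc)
qed

lemma bkm_form_base_right:
  assumes "pos_def A"
  shows "bkm_form A P A = Re (mtrace P)"
proof -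
  obtain U d where U: "unitary_mat U" and A: "A = unitary_diag U d" and d_pos: "\<And>i. 0 < d i"
    using pos_def_decomposition[OF assms] by blast
  let ?p = "\<lambda>i. trace_pair P (eigenproj U i)"
  have integrand: "(\<Sum>i\<in>UNIV. d i * (1 / (d i + r)\<^sup>2) * ?p i)
      = trace_pair P (resolvent A r ** A ** resolvent A r)"
    if "0 \<le> r" for r
    using assms that
    by (simp add: A resolvent_unitary_diag[OF U] unitary_diag_mult[OF U] trace_pair_unitary_diag[OF U]
        power2_eq_square)
  have "((\<lambda>r. \<Sum>i\<in>UNIV. d i * (1 / (d i + r)\<^sup>2) * ?p i)
      has_integral (\<Sum>i\<in>UNIV. d i * (1 / d i) * ?p i)) {0..}"
    by (intro has_integral_sum has_integral_mult_left has_integral_mult_right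
        has_integral_inverse_square d_pos finite)
  also have "(\<Sum>i\<in>UNIV. d i * (1 / d i) * ?p i) = Re (mtrace P)"
    using d_pos[THEN less_imp_neq, symmetric] by (simp add: sum_trace_pair_eigenproj[OF U])
  finally have "((\<lambda>r. trace_pair P (resolvent A r ** A ** resolvent A r)) has_integral Re (mtrace P)) {0..}"
    by (rule has_integral_eq[rotated]) (rule integrand, simp)
  then show ?thesis
    unfolding bkm_form_def by (rule integral_unique)
qed

lemma trace_pair_log_supp_tangent:
  assumes A: "pos_def A" and B: "pos_def B" and P: "psd P"
  shows "trace_pair P (log_supp B) - trace_pair P (log_supp A) \<le> bkm_form A P (B - A)"
proof (rule has_integral_le)
  show "((\<lambda>r. trace_pair P ((1 / (1 + r)) *\<^sub>R mat 1 - resolvent B r)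
        - trace_pair P ((1 / (1 + r)) *\<^sub>R mat 1 - resolvent A r))
      has_integral trace_pair P (log_supp B) - trace_pair P (log_supp A)) {0..}"
    by (intro has_integral_diff trace_pair_log_supp_has_integral A B)
  show "((\<lambda>r. trace_pair P (resolvent A r ** (B - A) ** resolvent A r))
      has_integral bkm_form A P (B - A)) {0..}"
    unfolding bkm_form_def by (intro integrable_integral bkm_form_integrable A)
  fix r :: real assume "r \<in> {0..}"
  then have "resolvent A r - resolvent B r \<preceq> resolvent A r ** (B - A) ** resolvent A r"
    using matrix_inv_tangent[OF pos_def_shift[OF A, of r] pos_def_shift[OF B, of r]]
    by (simp add: resolvent_def)
  then have "0 \<le> trace_pair P (resolvent A r ** (B - A) ** resolvent A r - (resolvent A r - resolvent B r))"
    unfolding loewner_le_def by (rule trace_pair_psd_nonneg[OF P])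
  then show "trace_pair P ((1 / (1 + r)) *\<^sub>R mat 1 - resolvent B r)
      - trace_pair P ((1 / (1 + r)) *\<^sub>R mat 1 - resolvent A r)
    \<le> trace_pair P (resolvent A r ** (B - A) ** resolvent A r)"
    by (simp add: trace_pair.diff_right)
qed

subsection \<open>The logarithm along a segment\<close>

lemma quadratic_form_bound_imp_cross_term_le:
  fixes p q u s a \<theta> :: real
  assumes "0 < a" "0 \<le> \<theta>" "0 \<le> s"
    and "a * p + \<theta> * u \<le> 1" and "a * u + \<theta> * q \<le> s" and "0 \<le> q - 2 * s * u + s\<^sup>2 * p"
  shows "u \<le> s / (a + \<theta> * s)"
proof -
  have pos: "0 < a + \<theta> * s"
    using assms(1-3) by (simp add: add_pos_nonneg)
  have "u * (a + \<theta> * s)\<^sup>2 = a * (a * u) + s\<^sup>2 * \<theta> * (\<theta> * u) + a * \<theta> * (2 * s * u)"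
    by (simp add: power2_eq_square algebra_simps)
  also have "\<dots> \<le> a * (s - \<theta> * q) + s\<^sup>2 * \<theta> * (1 - a * p) + a * \<theta> * (q + s\<^sup>2 * p)"
    using assms by (intro add_mono mult_left_mono) auto
  also have "\<dots> = s * (a + \<theta> * s)"
    by (simp add: power2_eq_square algebra_simps)
  finally have "u * (a + \<theta> * s) \<le> s"
    using pos by (simp add: power2_eq_square flip: mult.assoc)
  then show ?thesis using pos by (simp add: pos_le_divide_eq)
qed

lemma bkm_form_le:
  assumes D: "pos_def D" and P: "is_state P" and X: "psd X"
    and "0 < a" "0 \<le> \<theta>" and dom: "a *\<^sub>R P + \<theta> *\<^sub>R X \<preceq> D"
  shows "bkm_form D P X \<le> Re (mtrace X) / (a + \<theta> * Re (mtrace X))"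
proof (rule quadratic_form_bound_imp_cross_term_le[OF \<open>0 < a\<close> \<open>0 \<le> \<theta>\<close>])
  let ?s = "Re (mtrace X)"
  have psdP: "psd P" and trP: "mtrace P = 1"
    using P by (simp_all add: is_state_def)
  have dom': "psd (D - a *\<^sub>R P - \<theta> *\<^sub>R X)"
    using dom by (simp add: loewner_le_def diff_diff_eq)
  note expand = bkm_form_diff_left[OF D] bkm_form_diff_right[OF D] bkm_form_scaleR_left
    bkm_form_scaleR_right bkm_form_base_right[OF D] bkm_form_commute[of D X P]
  show "0 \<le> ?s" by (rule psd_mtrace_nonneg[OF X])
  show "a * bkm_form D P P + \<theta> * bkm_form D P X \<le> 1"
    using bkm_form_psd_nonneg[OF D psdP dom'] by (simp add: expand trP)
  show "a * bkm_form D P X + \<theta> * bkm_form D X X \<le> ?s"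
    using bkm_form_psd_nonneg[OF D X dom'] by (simp add: expand)
  have "hermitian_mat (X - ?s *\<^sub>R P)"
    by (intro hermitian_mat_diff hermitian_mat_scaleR psd_hermitian X psdP)
  from bkm_form_self_nonneg[OF D this]
  show "0 \<le> bkm_form D X X - 2 * ?s * bkm_form D P X + ?s\<^sup>2 * bkm_form D P P"
    by (simp add: expand power2_eq_square algebra_simps)
qed

lemma quadratic_increment_bound_imp_antimono:
  fixes f :: "real \<Rightarrow> real"
  assumes bound: "\<And>x y. a \<le> x \<Longrightarrow> x \<le> y \<Longrightarrow> y \<le> b \<Longrightarrow> f y - f x \<le> C * (y - x)\<^sup>2"
    and "a \<le> b"
  shows "f b \<le> f a"
proof -
  have bisect: "f y - f x \<le> C * (y - x)\<^sup>2 * (1 / 2) ^ n" if "a \<le> x" "x \<le> y" "y \<le> b" for x y n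
    using that
  proof (induction n arbitrary: x y)
    case (Suc n)
    let ?m = "(x + y) / 2"
    have "f y - f x \<le> C * (y - ?m)\<^sup>2 * (1 / 2) ^ n + C * (?m - x)\<^sup>2 * (1 / 2) ^ n"
      using Suc.IH[of x ?m] Suc.IH[of ?m y] Suc.prems by simp
    also have "\<dots> = C * (y - x)\<^sup>2 * (1 / 2) ^ Suc n"
      by (simp add: power2_eq_square field_simps)
    finally show ?case .
  qed (simp add: bound)
  have "(\<lambda>n. C * (b - a)\<^sup>2 * (1 / 2) ^ n) \<longlonglongrightarrow> C * (b - a)\<^sup>2 * 0"
    by (intro tendsto_intros LIMSEQ_power_zero) simp
  then have "f b - f a \<le> C * (b - a)\<^sup>2 * 0"
    by (rule LIMSEQ_le_const) (use bisect[of a b] \<open>a \<le> b\<close> in auto)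
  then show ?thesis by simp
qed

lemma ln_diff_ge_linear_minus_quadratic:
  fixes a x y :: real
  assumes "0 < a" "a \<le> x" "x \<le> y"
  shows "(y - x) / x \<le> ln y - ln x + ((y - x) / a)\<^sup>2"
proof -
  have pos: "0 < x" "0 < y" using assms by auto
  have "ln (x / y) \<le> x / y - 1"
    using pos by (intro ln_le_minus_one) simp
  then have "(y - x) / y \<le> ln y - ln x"
    using pos by (simp add: ln_div diff_divide_distrib)
  moreover have "(y - x) / x - (y - x) / y = (y - x)\<^sup>2 / (x * y)"
    using pos by (simp add: field_simps power2_eq_square)
  moreover have "(y - x)\<^sup>2 / (x * y) \<le> (y - x)\<^sup>2 / (a * a)"
    using assms pos by (intro divide_left_mono mult_mono) auto
  ultimately show ?thesis by (simp add: power_divide power2_eq_square)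
qed

lemma trace_pair_log_supp_mono_pos_def:
  assumes A: "pos_def A" and "A \<preceq> B" and P: "psd P"
  shows "trace_pair P (log_supp A) \<le> trace_pair P (log_supp B)"
proof -
  have BA: "psd (B - A)" using assms(2) by (simp add: loewner_le_def)
  then have B: "pos_def B" using pos_def_add_psd[OF A] by fastforce
  have "trace_pair P (log_supp A) - trace_pair P (log_supp B) \<le> bkm_form B P ((- 1) *\<^sub>R (B - A))"
    using trace_pair_log_supp_tangent[OF B A P] by simp
  also have "\<dots> \<le> 0"
    using bkm_form_psd_nonneg[OF B P BA] by (simp only: bkm_form_scaleR_right)
  finally show ?thesis by simp
qed

lemma trace_pair_log_supp_add_le_pos_def:
  assumes A: "pos_def A" and P: "is_state P" and X: "psd X" and "0 < a" and dom: "a *\<^sub>R P \<preceq> A"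
  shows "trace_pair P (log_supp (A + X)) - trace_pair P (log_supp A) \<le> ln (a + Re (mtrace X)) - ln a"
proof -
  define s where "s = Re (mtrace X)"
  have s_nonneg: "0 \<le> s" unfolding s_def by (rule psd_mtrace_nonneg[OF X])
  have psdP: "psd P" using P by (simp add: is_state_def)
  define L where "L \<theta> = trace_pair P (log_supp (A + \<theta> *\<^sub>R X))" for \<theta>
  have "L 1 - ln (a + 1 * s) \<le> L 0 - ln (a + 0 * s)"
  proof (rule quadratic_increment_bound_imp_antimono[where f = "\<lambda>\<theta>. L \<theta> - ln (a + \<theta> * s)"])
    fix \<theta> \<eta> :: real assume \<theta>: "0 \<le> \<theta>" "\<theta> \<le> \<eta>"
    let ?D = "A + \<theta> *\<^sub>R X"
    have pos_def: "pos_def ?D" "pos_def (A + \<eta> *\<^sub>R X)"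
      using \<theta> by (auto intro!: pos_def_add_psd A psd_scaleR X)
    have dom': "a *\<^sub>R P + \<theta> *\<^sub>R X \<preceq> ?D"
      using dom by (simp add: loewner_le_def)
    have "L \<eta> - L \<theta> \<le> bkm_form ?D P ((\<eta> - \<theta>) *\<^sub>R X)"
      using trace_pair_log_supp_tangent[OF pos_def psdP] by (simp add: L_def scaleR_diff_left)
    also have "\<dots> \<le> (\<eta> - \<theta>) * (s / (a + \<theta> * s))"
      unfolding bkm_form_scaleR_right s_def using \<theta> bkm_form_le[OF pos_def(1) P X \<open>0 < a\<close> \<theta>(1) dom']
      by (intro mult_left_mono) auto
    also have "\<dots> = ((a + \<eta> * s) - (a + \<theta> * s)) / (a + \<theta> * s)"
      by (simp add: algebra_simps)
    also have "\<dots> \<le> ln (a + \<eta> * s) - ln (a + \<theta> * s) + (((a + \<eta> * s) - (a + \<theta> * s)) / a)\<^sup>2"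
      using \<open>0 < a\<close> \<theta> s_nonneg by (intro ln_diff_ge_linear_minus_quadratic) (auto intro: mult_right_mono)
    also have "((a + \<eta> * s) - (a + \<theta> * s)) / a = s / a * (\<eta> - \<theta>)"
      by (simp add: field_simps)
    finally show "(L \<eta> - ln (a + \<eta> * s)) - (L \<theta> - ln (a + \<theta> * s)) \<le> (s / a)\<^sup>2 * (\<eta> - \<theta>)\<^sup>2"
      by (simp add: power_mult_distrib power_divide)
  qed simp
  then show ?thesis by (simp add: L_def s_def)
qed

subsection \<open>Singular matrices\<close>

lemma supp_le_trace_pair_eigenproj_zero:
  assumes U: "unitary_mat U" and "supp_le P (unitary_diag U d)" "d i = 0"
  shows "trace_pair P (eigenproj U i) = 0"
proof -
  have "unitary_diag U d *v column i U = 0"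
    using assms(3) by (simp add: unitary_diag_mult_column[OF U])
  then have "P *v column i U = 0"
    using assms(2) by (simp add: supp_le_def)
  then have "P ** eigenproj U i = 0"
    by (intro unitary_matrix_eqI[OF U])
      (simp add: eigenproj_mult_column[OF U] flip: matrix_vector_mul_assoc)
  then show ?thesis by (simp add: trace_pair_def mtrace_def)
qed

lemma trace_pair_log_supp_shift_tendsto:
  assumes A: "psd A" and "supp_le P A"
  shows "((\<lambda>e. trace_pair P (log_supp (A + e *\<^sub>R mat 1))) \<longlongrightarrow> trace_pair P (log_supp A)) (at_right 0)"
proof -
  obtain U d where U: "unitary_mat U" and A_eq: "A = unitary_diag U d" and d_nonneg: "\<And>i. 0 \<le> d i"
    using psd_decomposition[OF A] by blast
  let ?p = "\<lambda>i. trace_pair P (eigenproj U i)"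
  have "((\<lambda>e. ln (d i + e) * ?p i) \<longlongrightarrow> ln (d i) * ?p i) (at_right 0)" for i
  proof (cases "d i = 0")
    case True
    then show ?thesis
      using supp_le_trace_pair_eigenproj_zero[OF U, of P d i] assms(2) by (simp add: A_eq)
  next
    case False
    have "((\<lambda>e. ln (d i + e) * ?p i) \<longlongrightarrow> ln (d i + 0) * ?p i) (at_right 0)"
      using False by (intro tendsto_intros) auto
    then show ?thesis by simp
  qed
  then have "((\<lambda>e. \<Sum>i\<in>UNIV. ln (d i + e) * ?p i) \<longlongrightarrow> (\<Sum>i\<in>UNIV. ln (d i) * ?p i)) (at_right 0)"
    by (rule tendsto_sum)
  also have "(\<Sum>i\<in>UNIV. ln (d i) * ?p i) = trace_pair P (log_supp A)"
    by (simp add: A_eq trace_pair_log_supp_unitary_diag[OF U] d_nonneg)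
  finally show ?thesis
  proof (rule Lim_transform_eventually)
    show "\<forall>\<^sub>F e in at_right 0. (\<Sum>i\<in>UNIV. ln (d i + e) * ?p i) = trace_pair P (log_supp (A + e *\<^sub>R mat 1))"
      using eventually_at_right_less[of 0]
    proof eventually_elim
      case (elim e)
      then show ?case
        by (simp add: A_eq unitary_diag_shift[OF U] trace_pair_log_supp_unitary_diag[OF U] d_nonneg
            add_nonneg_nonneg)
    qed
  qed
qed

lemma loewner_le_imp_supp_le:
  assumes "psd A" "A \<preceq> B"
  shows "supp_le A B"
  unfolding supp_le_def
proof (intro allI impI)
  fix x assume "B *v x = 0"
  then have "cdot x ((B - A) *v x) = - cdot x (A *v x)"
    by (simp add: matrix_vector_mult.diff_left cdot.minus_right)
  moreover have "0 \<le> Re (cdot x ((B - A) *v x))" "0 \<le> Re (cdot x (A *v x))"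
    using assms by (simp_all add: loewner_le_def psd_cdot)
  ultimately show "A *v x = 0"
    by (intro psd_form_zero_imp_kernel[OF assms(1)]) simp
qed

lemma scaleR_loewner_le_imp_supp_le:
  assumes "0 < a" "psd A" "a *\<^sub>R A \<preceq> B"
  shows "supp_le A B"
  using loewner_le_imp_supp_le[OF psd_scaleR[OF assms(2)] assms(3)] assms(1)
  by (simp add: supp_le_def matrix_vector_scaleR)

lemma trace_pair_log_supp_mono:
  assumes A: "psd A" and "A \<preceq> B" and P: "psd P" "supp_le P A"
  shows "trace_pair P (log_supp A) \<le> trace_pair P (log_supp B)"
proof -
  have B: "psd B"
    using psd_add[OF A, of "B - A"] assms(2) by (simp add: loewner_le_def)
  have "supp_le P B"
    using P(2) loewner_le_imp_supp_le[OF A assms(2)] by (simp add: supp_le_def)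
  moreover have "\<forall>\<^sub>F e in at_right 0.
      trace_pair P (log_supp (A + e *\<^sub>R mat 1)) \<le> trace_pair P (log_supp (B + e *\<^sub>R mat 1))"
    using eventually_at_right_less[of 0]
    by eventually_elim (use assms(2) in \<open>auto intro!: trace_pair_log_supp_mono_pos_def
        psd_shift_pos_def A P simp: loewner_le_def\<close>)
  ultimately show ?thesis
    using tendsto_le[OF trivial_limit_at_right_real] trace_pair_log_supp_shift_tendsto A B P(2)
    by blast
qed

lemma trace_pair_log_supp_add_le:
  assumes P: "is_state P" and X: "psd X" and "0 < a" and dom: "a *\<^sub>R P \<preceq> A"
  shows "trace_pair P (log_supp (A + X)) - trace_pair P (log_supp A) \<le> ln (a + Re (mtrace X)) - ln a"
proof -
  have psdP: "psd P" using P by (simp add: is_state_def)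
  have A: "psd A"
    using psd_add[OF psd_scaleR[OF psdP], of a "A - a *\<^sub>R P"] dom \<open>0 < a\<close> by (simp add: loewner_le_def)
  have dom': "a *\<^sub>R P \<preceq> A + X"
    using psd_add[OF dom[unfolded loewner_le_def] X] by (simp add: loewner_le_def algebra_simps)
  let ?L = "\<lambda>D. trace_pair P (log_supp D)"
  have "((\<lambda>e. ?L (A + X + e *\<^sub>R mat 1) - ?L (A + e *\<^sub>R mat 1)) \<longlongrightarrow> ?L (A + X) - ?L A) (at_right 0)"
    by (intro tendsto_diff trace_pair_log_supp_shift_tendsto psd_add A X
        scaleR_loewner_le_imp_supp_le[OF \<open>0 < a\<close> psdP] dom dom')
  then show ?thesis
  proof (rule tendsto_upperbound)
    show "\<forall>\<^sub>F e in at_right 0.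
        ?L (A + X + e *\<^sub>R mat 1) - ?L (A + e *\<^sub>R mat 1) \<le> ln (a + Re (mtrace X)) - ln a"
      using eventually_at_right_less[of 0]
    proof eventually_elim
      case (elim e)
      have "a *\<^sub>R P \<preceq> A + e *\<^sub>R mat 1"
        using psd_add[OF dom[unfolded loewner_le_def] psd_scaleR[OF psd_mat_1, of e]] elim
        by (simp add: loewner_le_def algebra_simps)
      from trace_pair_log_supp_add_le_pos_def[OF psd_shift_pos_def[OF A elim] P X \<open>0 < a\<close> this]
      show ?case by (simp add: add_ac)
    qed
  qed simp
qed

lemma trace_pair_log_supp_scaleR:
  assumes "psd A" "supp_le P A" "0 < c"
  shows "trace_pair P (log_supp (c *\<^sub>R A)) = ln c * Re (mtrace P) + trace_pair P (log_supp A)"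
proof -
  obtain U d where U: "unitary_mat U" and A: "A = unitary_diag U d" and d_nonneg: "\<And>i. 0 \<le> d i"
    using psd_decomposition[OF assms(1)] by blast
  let ?p = "\<lambda>i. trace_pair P (eigenproj U i)"
  have "ln (c * d i) * ?p i = ln c * ?p i + ln (d i) * ?p i" for i
  proof (cases "d i = 0")
    case True
    then show ?thesis
      using supp_le_trace_pair_eigenproj_zero[OF U, of P d i] assms(2) by (simp add: A)
  next
    case False
    then show ?thesis using d_nonneg[of i] \<open>0 < c\<close> by (simp add: ln_mult distrib_right)
  qed
  then have "(\<Sum>i\<in>UNIV. ln (c * d i) * ?p i) = ln c * Re (mtrace P) + (\<Sum>i\<in>UNIV. ln (d i) * ?p i)"
    by (simp add: sum.distrib sum_trace_pair_eigenproj[OF U] flip: sum_distrib_left)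
  then show ?thesis
    using \<open>0 < c\<close>
    by (simp add: A unitary_diag_scaleR[OF U] trace_pair_log_supp_unitary_diag[OF U] d_nonneg)
qed

subsection \<open>Telescopic relative entropy\<close>

lemma one_minus_tel_rel_ent_scalar:
  assumes "0 < a" "a < 1"
  shows "1 - tel_rel_ent_scalar a 1 t = (ln (a + (1 - a) * t) - ln a) / (- ln a)"
  using assms by (simp add: tel_rel_ent_scalar_def field_simps)

lemma ln_increment_ratio_le:
  fixes a t :: real
  assumes "0 < a" "a < 1" "0 \<le> t"
  shows "(ln (a + (1 - a) * t) - ln a) / (- ln a) \<le> (1 - a) / (- a * ln a) * t"
proof -
  have pos: "0 < a + (1 - a) * t"
    using assms by (simp add: add_pos_nonneg)
  have "ln (a + (1 - a) * t) - ln a = ln ((a + (1 - a) * t) / a)"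
    using assms(1) pos by (simp add: ln_div)
  also have "\<dots> \<le> (a + (1 - a) * t) / a - 1"
    using assms(1) pos by (intro ln_le_minus_one) simp
  also have "\<dots> = (1 - a) * t / a"
    using assms(1) by (simp add: field_simps)
  finally have "(ln (a + (1 - a) * t) - ln a) / (- ln a) \<le> ((1 - a) * t / a) / (- ln a)"
    using assms by (intro divide_right_mono) auto
  then show ?thesis by simp
qed

lemma pos_part_diff_pos_part_uminus:
  assumes "hermitian_mat A"
  shows "pos_part A - pos_part (- A) = A"
proof -
  obtain U d where U: "unitary_mat U" and A: "A = unitary_diag U d"
    using spectral_decomposition[OF assms] .
  have uminus: "- A = unitary_diag U (\<lambda>i. - d i)"
    using unitary_diag_scaleR[OF U, of "- 1" d] by (simp add: A)
  have "pos_part A = unitary_diag U (\<lambda>i. d i + max (- d i) 0)"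
    unfolding pos_part_def A mat_fun_unitary_diag[OF U] by (rule arg_cong[of _ _ "unitary_diag U"]) auto
  also have "\<dots> = A + pos_part (- A)"
    by (simp add: pos_part_def uminus mat_fun_unitary_diag[OF U] flip: unitary_diag_add[OF U] A)
  finally show ?thesis by simp
qed

lemma psd_pos_part:
  assumes "hermitian_mat A"
  shows "psd (pos_part A)"
proof -
  obtain U d where "unitary_mat U" "A = unitary_diag U d"
    using spectral_decomposition[OF assms] .
  then show ?thesis by (simp add: pos_part_def mat_fun_unitary_diag psd_unitary_diag_iff)
qed

lemma loewner_le_add_pos_part:
  assumes "hermitian_mat A" "hermitian_mat B"
  shows "B \<preceq> A + pos_part (B - A)"
proof -
  have "A + pos_part (B - A) - B = pos_part (A - B)"
    using pos_part_diff_pos_part_uminus[OF hermitian_mat_diff[OF assms(2,1)]] by (simp add: algebra_simps)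
  then show ?thesis
    by (simp add: loewner_le_def psd_pos_part hermitian_mat_diff assms)
qed

lemma trace_dist_nonneg:
  "hermitian_mat A \<Longrightarrow> hermitian_mat B \<Longrightarrow> 0 \<le> trace_dist A B"
  unfolding trace_dist_def by (intro psd_mtrace_nonneg psd_pos_part hermitian_mat_diff)

lemma trace_dist_commute:
  assumes "hermitian_mat A" "hermitian_mat B" "mtrace A = mtrace B"
  shows "trace_dist A B = trace_dist B A"
proof -
  have "mtrace (pos_part (A - B)) - mtrace (pos_part (B - A)) = mtrace (A - B)"
    using pos_part_diff_pos_part_uminus[OF hermitian_mat_diff[OF assms(1,2)]]
    by (simp flip: mtrace_diff)
  then show ?thesis
    using assms(3) by (simp add: trace_dist_def mtrace_diff)
qed

definition trace_log_mix :: "real \<Rightarrow> 'n::finite cmat \<Rightarrow> 'n cmat \<Rightarrow> real" where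
  "trace_log_mix a \<rho> \<sigma> = trace_pair \<rho> (log_supp (a *\<^sub>R \<rho> + (1 - a) *\<^sub>R \<sigma>))"

lemma scaleR_loewner_le_convex_combination:
  "psd \<sigma> \<Longrightarrow> a \<le> 1 \<Longrightarrow> a *\<^sub>R \<rho> \<preceq> a *\<^sub>R \<rho> + (1 - a) *\<^sub>R \<sigma>"
  by (simp add: loewner_le_def psd_scaleR)

lemma supp_le_convex_combination:
  assumes "psd \<rho>" "psd \<sigma>" "0 < a" "a \<le> 1"
  shows "supp_le \<rho> (a *\<^sub>R \<rho> + (1 - a) *\<^sub>R \<sigma>)"
  using assms by (intro scaleR_loewner_le_imp_supp_le[of a] scaleR_loewner_le_convex_combination)

lemma tel_rel_ent_eq:
  assumes "psd \<rho>" "psd \<sigma>" "0 < a" "a < 1"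
  shows "tel_rel_ent a \<rho> \<sigma> = ereal ((trace_pair \<rho> (log_supp \<rho>) - trace_log_mix a \<rho> \<sigma>) / (- ln a))"
  using assms by (simp add: tel_rel_ent_def rel_ent_def supp_le_convex_combination trace_log_mix_def
      trace_pair.diff_right flip: trace_pair_def)

lemma abs_tel_rel_ent_diff:
  assumes "psd \<rho>" "psd \<sigma>" "psd \<tau>" "0 < a" "a < 1"
  shows "\<bar>tel_rel_ent a \<rho> \<sigma> - tel_rel_ent a \<rho> \<tau>\<bar>
      = ereal (\<bar>trace_log_mix a \<rho> \<tau> - trace_log_mix a \<rho> \<sigma>\<bar> / (- ln a))"
proof -
  define k where "k = - ln a"
  have "0 < k" using assms(4,5) by (simp add: k_def)
  then show ?thesis
    using assms by (simp add: tel_rel_ent_eq flip: k_def diff_divide_distrib)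
qed

lemma trace_log_mix_diff_le:
  assumes \<rho>: "is_state \<rho>" and \<sigma>: "psd \<sigma>" and \<tau>: "psd \<tau>" and weight: "0 < a" "a < 1"
  shows "trace_log_mix a \<rho> \<tau> - trace_log_mix a \<rho> \<sigma> \<le> ln (a + (1 - a) * trace_dist \<tau> \<sigma>) - ln a"
proof -
  let ?D = "\<lambda>\<sigma>. a *\<^sub>R \<rho> + (1 - a) *\<^sub>R \<sigma>" and ?X = "pos_part (\<tau> - \<sigma>)"
  have psd\<rho>: "psd \<rho>" using \<rho> by (simp add: is_state_def)
  have "psd ((1 - a) *\<^sub>R (\<sigma> + ?X - \<tau>))"
    using loewner_le_add_pos_part[OF psd_hermitian[OF \<sigma>] psd_hermitian[OF \<tau>]] weight(2)
    by (intro psd_scaleR) (simp_all add: loewner_le_def)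
  then have "?D \<tau> \<preceq> ?D \<sigma> + (1 - a) *\<^sub>R ?X"
    by (simp add: loewner_le_def algebra_simps)
  moreover have "psd (?D \<tau>)"
    using weight by (intro psd_add psd_scaleR psd\<rho> \<tau>) auto
  moreover have "supp_le \<rho> (?D \<tau>)"
    using weight by (intro supp_le_convex_combination psd\<rho> \<tau>) auto
  ultimately have "trace_log_mix a \<rho> \<tau> \<le> trace_pair \<rho> (log_supp (?D \<sigma> + (1 - a) *\<^sub>R ?X))"
    unfolding trace_log_mix_def using psd\<rho> by (intro trace_pair_log_supp_mono)
  moreover have "trace_pair \<rho> (log_supp (?D \<sigma> + (1 - a) *\<^sub>R ?X)) - trace_log_mix a \<rho> \<sigma>
      \<le> ln (a + Re (mtrace ((1 - a) *\<^sub>R ?X))) - ln a"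
    unfolding trace_log_mix_def using weight
    by (intro trace_pair_log_supp_add_le \<rho> psd_scaleR scaleR_loewner_le_convex_combination
        psd_pos_part hermitian_mat_diff psd_hermitian \<sigma> \<tau>) auto
  ultimately show ?thesis by (simp add: mtrace_scaleR trace_dist_def)
qed

lemma abs_trace_log_mix_diff_le:
  assumes "is_state \<rho>" and \<sigma>: "is_state \<sigma>" and \<tau>: "is_state \<tau>" and weight: "0 < a" "a < 1"
  shows "\<bar>trace_log_mix a \<rho> \<tau> - trace_log_mix a \<rho> \<sigma>\<bar> \<le> ln (a + (1 - a) * trace_dist \<sigma> \<tau>) - ln a"
proof -
  have "trace_dist \<sigma> \<tau> = trace_dist \<tau> \<sigma>"
    using \<sigma> \<tau> by (intro trace_dist_commute) (simp_all add: is_state_def psd_hermitian)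
  then show ?thesis
    using trace_log_mix_diff_le[OF assms(1) _ _ weight] \<sigma> \<tau> by (force simp: is_state_def abs_le_iff)
qed

lemma trace_pair_log_supp_add_orthogonal:
  assumes P: "psd P" and Q: "psd Q" and "mtrace (P ** Q) = 0" and "0 < c"
  shows "trace_pair P (log_supp (c *\<^sub>R P + k *\<^sub>R Q)) = ln c * Re (mtrace P) + trace_pair P (log_supp P)"
proof -
  have "Q ** P = 0"
    using psd_mtrace_mult_zero_imp_mult_zero[OF Q P] assms(3) by (simp add: mtrace_mult_commute[of Q])
  then have "(c *\<^sub>R P + k *\<^sub>R Q) ** P = P ** (c *\<^sub>R P)"
    by (simp add: matrix_mult.add_left matrix_mult.scaleR_left matrix_mult.scaleR_right)
  moreover have "hermitian_mat (c *\<^sub>R P + k *\<^sub>R Q)" "hermitian_mat (c *\<^sub>R P)"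
    by (intro hermitian_mat_add hermitian_mat_scaleR psd_hermitian P Q)+
  ultimately have "log_supp (c *\<^sub>R P + k *\<^sub>R Q) ** P = P ** log_supp (c *\<^sub>R P)"
    unfolding log_supp_def by (intro mat_fun_intertwines)
  then have "trace_pair P (log_supp (c *\<^sub>R P + k *\<^sub>R Q)) = trace_pair P (log_supp (c *\<^sub>R P))"
    by (subst trace_pair_commute) (simp add: trace_pair_def)
  then show ?thesis
    using trace_pair_log_supp_scaleR[OF P _ \<open>0 < c\<close>, of P] by (simp add: supp_le_def)
qed

lemma trace_log_mix_diff_orthogonal:
  assumes \<rho>: "is_state \<rho>" and \<sigma>: "psd \<sigma>" and "mtrace (\<rho> ** \<sigma>) = 0"
    and weight: "0 < a" "a < 1" and "0 \<le> t"
  shows "trace_log_mix a \<rho> (t *\<^sub>R \<rho> + (1 - t) *\<^sub>R \<sigma>) - trace_log_mix a \<rho> \<sigma> = ln (a + (1 - a) * t) - ln a"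
proof -
  let ?L = "trace_pair \<rho> (log_supp \<rho>)"
  have orthogonal: "trace_pair \<rho> (log_supp (c *\<^sub>R \<rho> + k *\<^sub>R \<sigma>)) = ln c + ?L" if "0 < c" for c k
    using trace_pair_log_supp_add_orthogonal[OF _ \<sigma> assms(3) that] \<rho> by (simp add: is_state_def)
  have "a *\<^sub>R \<rho> + (1 - a) *\<^sub>R (t *\<^sub>R \<rho> + (1 - t) *\<^sub>R \<sigma>)
      = (a + (1 - a) * t) *\<^sub>R \<rho> + ((1 - a) * (1 - t)) *\<^sub>R \<sigma>"
    by (simp add: scaleR_add_left scaleR_add_right)
  then have "trace_log_mix a \<rho> (t *\<^sub>R \<rho> + (1 - t) *\<^sub>R \<sigma>) = ln (a + (1 - a) * t) + ?L"
    unfolding trace_log_mix_def using orthogonal weight \<open>0 \<le> t\<close> by (simp add: add_pos_nonneg)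
  moreover have "trace_log_mix a \<rho> \<sigma> = ln a + ?L"
    unfolding trace_log_mix_def using orthogonal weight by simp
  ultimately show ?thesis by simp
qed

theorem theorem3:
  fixes \<rho> \<sigma>1 \<sigma>2 :: "complex^'n::finite^'n"
    and a t :: real
  assumes "0 < a" and "a < 1"
    and "is_state \<rho>" and "is_state \<sigma>1" and "is_state \<sigma>2"
    and "trace_dist \<sigma>1 \<sigma>2 = t"
  shows "\<bar>tel_rel_ent a \<rho> \<sigma>1 - tel_rel_ent a \<rho> \<sigma>2\<bar> \<le> ereal (1 - tel_rel_ent_scalar a 1 t) \<and>
         1 - tel_rel_ent_scalar a 1 t = (ln (a + (1 - a) * t) - ln a) / (- ln a) \<and>
         (ln (a + (1 - a) * t) - ln a) / (- ln a) \<le> (1 - a) / (- a * ln a) * t \<and>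
         (mtrace (\<rho> ** \<sigma>1) = 0 \<and> \<sigma>2 = t *\<^sub>R \<rho> + (1 - t) *\<^sub>R \<sigma>1 \<longrightarrow>
         \<bar>tel_rel_ent a \<rho> \<sigma>1 - tel_rel_ent a \<rho> \<sigma>2\<bar> = ereal (1 - tel_rel_ent_scalar a 1 t))"
proof (intro conjI impI)
  note weight = assms(1,2)
  have \<rho>: "psd \<rho>" and \<sigma>: "psd \<sigma>1" "psd \<sigma>2"
    using assms(3-5) by (simp_all add: is_state_def)
  have t_nonneg: "0 \<le> t"
    using trace_dist_nonneg[OF \<sigma>[THEN psd_hermitian]] assms(6) by simp
  note abs_diff = abs_tel_rel_ent_diff[OF \<rho> \<sigma> weight]
  note scalar = one_minus_tel_rel_ent_scalar[OF weight]
  have bound: "\<bar>trace_log_mix a \<rho> \<sigma>2 - trace_log_mix a \<rho> \<sigma>1\<bar> \<le> ln (a + (1 - a) * t) - ln a"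
    using abs_trace_log_mix_diff_le[OF assms(3-5) weight] assms(6) by simp
  then show "\<bar>tel_rel_ent a \<rho> \<sigma>1 - tel_rel_ent a \<rho> \<sigma>2\<bar> \<le> ereal (1 - tel_rel_ent_scalar a 1 t)"
    unfolding abs_diff scalar ereal_less_eq using weight by (intro divide_right_mono) simp_all
  show "1 - tel_rel_ent_scalar a 1 t = (ln (a + (1 - a) * t) - ln a) / (- ln a)"
    by (rule scalar)
  show "(ln (a + (1 - a) * t) - ln a) / (- ln a) \<le> (1 - a) / (- a * ln a) * t"
    by (rule ln_increment_ratio_le[OF weight t_nonneg])
  assume "mtrace (\<rho> ** \<sigma>1) = 0 \<and> \<sigma>2 = t *\<^sub>R \<rho> + (1 - t) *\<^sub>R \<sigma>1"
  then have "trace_log_mix a \<rho> \<sigma>2 - trace_log_mix a \<rho> \<sigma>1 = ln (a + (1 - a) * t) - ln a"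
    using trace_log_mix_diff_orthogonal[OF assms(3) \<sigma>(1) _ weight t_nonneg] by simp
  with bound show "\<bar>tel_rel_ent a \<rho> \<sigma>1 - tel_rel_ent a \<rho> \<sigma>2\<bar> = ereal (1 - tel_rel_ent_scalar a 1 t)"
    unfolding abs_diff scalar by simp
qed

end
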